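(* Let $G=(V,E)$ be a finite, loopless, connected multi-graph with $V=\{v_1,\dots,v_n\}$ and $E=\{e_1,\dots,e_m\}$, and let $\omega$ be the weight function on $E$ given by $\omega(e_j)=y_j$ for $j\in\{1,\dots,m\}$, where $y_1,\dots,y_m$ are indeterminates. Then $$\prod_{i=1}^{n-1}\ \sum_{e_j\in E_G(v_i)}y_j=\tau(G,\omega)+\sum_{T_0\in \mathrm{NST}_{v_n}(G)}\tau(T_0,\omega)\,F(G-V(T_0),\omega).$$
   Context: $E_G(v)$ is the set of edges of $G$ incident with $v$. For a tree $T$ (a subgraph of $G$), $\tau(T,\omega)=\prod_{e_j\in E(T)}y_j$ if $E(T)\neq\emptyset$, and $\tau(T,\omega)=1$ if $E(T)=\emptyset$. $\tau(G,\omega)=\sum_{T}\tau(T,\omega)$, the sum over all spanning trees $T$ of $G$ (spanning trees are counted as edge sets). $\mathrm{NST}_{v_n}(G)$ is the set of subtrees $T_0$ of $G$ (subgraphs that are trees, distinct edge sets counted separately) with $v_n\in V(T_0)$ and $V(T_0)\neq V$; it includes the single-vertex tree $\{v_n\}$. For $S\subsetneq V$, $G-S$ is the subgraph of $G$ induced by $V\setminus S$. For a multi-graph $H$ whose edges are among $e_1,\dots,e_m$, $F(H,\omega)=\prod_{v\in V(H)}\sum_{e_j\in E_H(v)}y_j$ if $V(H)\neq\emptyset$, and $F(H,\omega)=1$ if $V(H)=\emptyset$, where $E_H(v)$ is the set of edges of $H$ incident with $v$. *)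

theory Defs
  imports "HOL-Library.Poly_Mapping"
begin

text \<open>Distinct edges may have the same set of ends; a loop is an edge with a single end.\<close>

record ('v, 'e) mgraph =
  verts :: "'v set"
  edges :: "'e set"
  ends :: "'e \<Rightarrow> 'v set"

definition finite_multigraph :: "('v, 'e) mgraph \<Rightarrow> bool" where
  "finite_multigraph G \<longleftrightarrow> finite (verts G) \<and> finite (edges G) \<and>
     (\<forall>a\<in>edges G. ends G a \<subseteq> verts G \<and> card (ends G a) \<in> {1, 2})"

definition loopless :: "('v, 'e) mgraph \<Rightarrow> bool" where
  "loopless G \<longleftrightarrow> (\<forall>a\<in>edges G. card (ends G a) \<noteq> 1)"

definition incident_edges :: "('v, 'e) mgraph \<Rightarrow> 'v \<Rightarrow> 'e set" where
  "incident_edges G u = {a \<in> edges G. u \<in> ends G a}"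

definition adjacency :: "('v, 'e) mgraph \<Rightarrow> ('v \<times> 'v) set" where
  "adjacency G = {(u, w). \<exists>a\<in>edges G. ends G a = {u, w}}"

definition connected_graph :: "('v, 'e) mgraph \<Rightarrow> bool" where
  "connected_graph G \<longleftrightarrow> verts G \<noteq> {} \<and>
     (\<forall>u\<in>verts G. \<forall>w\<in>verts G. (u, w) \<in> (adjacency G)\<^sup>*)"

text \<open>Cycles of length 1 are loops; cycles of length 2 are pairs of parallel edges.\<close>

definition is_cycle :: "('v, 'e) mgraph \<Rightarrow> 'v list \<Rightarrow> 'e list \<Rightarrow> bool" where
  "is_cycle G us as \<longleftrightarrow> as \<noteq> [] \<and> length us = length as \<and> distinct us \<and> distinct as \<and>
     set us \<subseteq> verts G \<and> set as \<subseteq> edges G \<and>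
     (\<forall>i<length as. ends G (as ! i) = {us ! i, us ! (Suc i mod length as)})"

definition is_tree :: "('v, 'e) mgraph \<Rightarrow> bool" where
  "is_tree T \<longleftrightarrow> connected_graph T \<and> (\<nexists>us as. is_cycle T us as)"

text \<open>
  A subgraph keeps the whole function \<open>ends\<close>, also outside its own edges, so that it is
  determined by its vertices and edges and no subgraph is counted twice in a sum.
\<close>

definition subgraph :: "('v, 'e) mgraph \<Rightarrow> ('v, 'e) mgraph \<Rightarrow> bool" where
  "subgraph H G \<longleftrightarrow> verts H \<subseteq> verts G \<and> edges H \<subseteq> edges G \<and> ends H = ends G \<and>
     (\<forall>a\<in>edges H. ends H a \<subseteq> verts H)"

lemma finite_subgraphs:
  assumes "finite_multigraph G"
  shows "finite {H. subgraph H G}"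
proof (rule finite_subset)
  let ?f = "\<lambda>(W, A). \<lparr>verts = W, edges = A, ends = ends G\<rparr>"
  show "finite (?f ` (Pow (verts G) \<times> Pow (edges G)))"
    using assms by (simp add: finite_multigraph_def)
  show "{H. subgraph H G} \<subseteq> ?f ` (Pow (verts G) \<times> Pow (edges G))"
  proof
    fix H assume "H \<in> {H. subgraph H G}"
    then have "H = ?f (verts H, edges H)" "(verts H, edges H) \<in> Pow (verts G) \<times> Pow (edges G)"
      by (auto simp: subgraph_def)
    then show "H \<in> ?f ` (Pow (verts G) \<times> Pow (edges G))"
      by (rule image_eqI)
  qed
qed

definition spanning_trees :: "('v, 'e) mgraph \<Rightarrow> ('v, 'e) mgraph set" where
  "spanning_trees G = {T. subgraph T G \<and> is_tree T \<and> verts T = verts G}"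

definition NST :: "'v \<Rightarrow> ('v, 'e) mgraph \<Rightarrow> ('v, 'e) mgraph set" where
  "NST r G = {T. subgraph T G \<and> is_tree T \<and> r \<in> verts T \<and> verts T \<noteq> verts G}"

definition delete_verts :: "('v, 'e) mgraph \<Rightarrow> 'v set \<Rightarrow> ('v, 'e) mgraph" where
  "delete_verts G S = \<lparr>verts = verts G - S,
     edges = {a \<in> edges G. ends G a \<subseteq> verts G - S}, ends = ends G\<rparr>"

definition tree_weight :: "('v, 'e) mgraph \<Rightarrow> ('e \<Rightarrow> 'r::comm_semiring_1) \<Rightarrow> 'r" where
  "tree_weight T \<omega> = (\<Prod>a\<in>edges T. \<omega> a)"

definition spanning_tree_sum :: "('v, 'e) mgraph \<Rightarrow> ('e \<Rightarrow> 'r::comm_semiring_1) \<Rightarrow> 'r" where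
  "spanning_tree_sum G \<omega> = (\<Sum>T\<in>spanning_trees G. tree_weight T \<omega>)"

definition degree_product :: "('v, 'e) mgraph \<Rightarrow> ('e \<Rightarrow> 'r::comm_semiring_1) \<Rightarrow> 'r" where
  "degree_product H \<omega> = (\<Prod>u\<in>verts H. \<Sum>a\<in>incident_edges H u. \<omega> a)"

text \<open>
  The multivariate polynomial ring over \<open>'k\<close> in variables indexed by \<open>nat\<close> is
  \<open>(nat \<Rightarrow>\<^sub>0 nat) \<Rightarrow>\<^sub>0 'k\<close>: finitely supported maps from monomials (exponent vectors) to
  coefficients.
\<close>

definition indeterminate :: "nat \<Rightarrow> (nat \<Rightarrow>\<^sub>0 nat) \<Rightarrow>\<^sub>0 'k::comm_ring_1" where
  "indeterminate j = Poly_Mapping.single (Poly_Mapping.single j 1) 1"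

end

theory Submission
  imports Defs "HOL-Library.FuncSet"
begin

text \<open>
  Put \<open>r = v n\<close>. Expanding the product, a term is a function \<open>f\<close> that chooses for every vertex
  other than \<open>r\<close> an incident edge. Walking along the chosen edges, a vertex either ends up in \<open>r\<close>
  or runs into a cycle. The vertices that reach \<open>r\<close>, together with the edges they choose, form a
  tree \<open>T\<close> through \<open>r\<close>, in which every vertex has chosen the edge towards \<open>r\<close>; every tree through
  \<open>r\<close> arises from exactly one such choice. The remaining vertices choose edges that avoid \<open>T\<close>, and
  otherwise arbitrary ones, which accounts for the factor \<open>F(G - V(T))\<close>.
\<close>

section \<open>Paths and distances\<close>

text \<open>Indexed like \<open>is_cycle\<close>, with one more vertex than edges: appending a
  closing edge to \<open>as\<close> turns a path into a cycle with the same
  \<open>us\<close>.\<close>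

definition is_path :: "('v, 'e) mgraph \<Rightarrow> 'v list \<Rightarrow> 'e list \<Rightarrow> bool" where
  "is_path G us as \<longleftrightarrow> length us = Suc (length as) \<and> distinct us \<and>
     set us \<subseteq> verts G \<and> set as \<subseteq> edges G \<and>
     (\<forall>i<length as. ends G (as ! i) = {us ! i, us ! Suc i})"

text \<open>An edge at positions \<open>i\<close> and \<open>j\<close> joins the same two vertices
  both times. As vertices do not repeat, \<open>i = j\<close>; the reversed match would need
  \<open>i = Suc j\<close> and \<open>Suc i = j\<close>.\<close>

lemma is_path_distinct_edges:
  assumes "is_path G us as"
  shows "distinct as"
proof -
  have "i = j" if ij: "i < length as" "j < length as" "as ! i = as ! j" for i j
  proof -
    have "{us ! i, us ! Suc i} = {us ! j, us ! Suc j}"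
      using assms ij unfolding is_path_def by metis
    then have "us ! i = us ! j \<or> us ! i = us ! Suc j \<and> us ! Suc i = us ! j"
      by (auto simp: doubleton_eq_iff)
    moreover have "us ! k = us ! l \<longleftrightarrow> k = l" if "k \<le> length as" "l \<le> length as" for k l
      using assms that by (simp add: is_path_def nth_eq_iff_index_eq)
    ultimately show ?thesis using ij by fastforce
  qed
  then show ?thesis by (auto simp: distinct_conv_nth)
qed

text \<open>A walk is followed step by step. If its next vertex already lies on the path, the path
  is cut off there; otherwise it is extended by one edge.\<close>

lemma connected_imp_path:
  assumes "(u, w) \<in> (adjacency G)\<^sup>*" and "u \<in> verts G"
    and inc: "\<And>a. a \<in> edges G \<Longrightarrow> ends G a \<subseteq> verts G"
  obtains us as where "is_path G us as" "us ! 0 = u" "us ! length as = w"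
proof -
  from assms(1) have "\<exists>us as. is_path G us as \<and> us ! 0 = u \<and> us ! length as = w"
  proof (induction rule: rtrancl_induct)
    case base
    have "is_path G [u] []" using assms(2) by (simp add: is_path_def)
    then show ?case by (intro exI[of _ "[u]"] exI[of _ "[]"]) simp
  next
    case (step y z)
    then obtain us as where p: "is_path G us as" "us ! 0 = u" "us ! length as = y" by blast
    from step(2) obtain a where a: "a \<in> edges G" "ends G a = {y, z}"
      by (auto simp: adjacency_def)
    show ?case
    proof (cases "z \<in> set us")
      case True
      then obtain k where k: "k < length us" "us ! k = z" by (auto simp: in_set_conv_nth)
      have "is_path G (take (Suc k) us) (take k as)"
        using p(1) k(1) by (auto simp: is_path_def dest: in_set_takeD)
      moreover have "length (take k as) = k" using p(1) k(1) by (simp add: is_path_def)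
      ultimately show ?thesis using p(2) k
        by (intro exI[of _ "take (Suc k) us"] exI[of _ "take k as"]) simp
    next
      case False
      have z: "z \<in> verts G" using inc[OF a(1)] a(2) by simp
      have "is_path G (us @ [z]) (as @ [a])"
        using p(1,3) a z False by (auto simp: is_path_def nth_append less_Suc_eq)
      moreover have "(us @ [z]) ! 0 = u" "(us @ [z]) ! length (as @ [a]) = z"
        using p(1,2) by (auto simp: is_path_def nth_append)
      ultimately show ?thesis by blast
    qed
  qed
  then show ?thesis using that by blast
qed

lemma path_closing_edge_imp_cycle:
  assumes p: "is_path G us as" and a: "a \<in> edges G" "a \<notin> set as"
    and "ends G a = {us ! 0, us ! length as}"
  shows "is_cycle G us (as @ [a])"
proof -
  have "distinct as" by (rule is_path_distinct_edges[OF p])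
  moreover have "Suc i mod Suc (length as) = Suc i" if "i < length as" for i
    using that by simp
  ultimately show ?thesis
    using assms unfolding is_cycle_def is_path_def
    by (auto simp: nth_append less_Suc_eq insert_commute)
qed

text \<open>The length of a shortest walk from \<open>u\<close> to \<open>r\<close>, meaningful only
  if there is one. It serves as the measure both for \<open>step f\<close> and for the adjacency of
  a given tree.\<close>

definition steps_to :: "('a \<times> 'a) set \<Rightarrow> 'a \<Rightarrow> 'a \<Rightarrow> nat" where
  "steps_to R r u = (LEAST k. (u, r) \<in> R ^^ k)"

lemma steps_to_decrease:
  assumes "(u, r) \<in> R\<^sup>*" "u \<noteq> r"
  obtains w where "(u, w) \<in> R" "(w, r) \<in> R\<^sup>*" "steps_to R r w < steps_to R r u"
proof -
  have "\<exists>k. (u, r) \<in> R ^^ k" using assms(1) by (rule rtrancl_imp_relpow)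
  then have k: "(u, r) \<in> R ^^ steps_to R r u"
    unfolding steps_to_def by (rule LeastI_ex)
  with assms(2) obtain j where j: "steps_to R r u = Suc j" by (cases "steps_to R r u") auto
  with k obtain w where w: "(u, w) \<in> R" "(w, r) \<in> R ^^ j"
    by (metis relpow_Suc_D2)
  have "steps_to R r w \<le> j" unfolding steps_to_def using w(2) by (rule Least_le)
  then show ?thesis using that w j by (simp add: relpow_imp_rtrancl)
qed

section \<open>The tree of vertices that reach the root\<close>

locale rooted_multigraph =
  fixes G :: "('v, 'e) mgraph" and r :: 'v
  assumes finite_G: "finite_multigraph G" and loopless_G: "loopless G" and root: "r \<in> verts G"
begin

lemma finite_verts: "finite (verts G)" and finite_edges: "finite (edges G)"
  using finite_G by (auto simp: finite_multigraph_def)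

lemma ends_subset: "a \<in> edges G \<Longrightarrow> ends G a \<subseteq> verts G"
  using finite_G by (auto simp: finite_multigraph_def)

lemma other_end:
  assumes "a \<in> edges G" "u \<in> ends G a"
  obtains w where "ends G a = {u, w}" "w \<noteq> u" "w \<in> verts G"
proof -
  have "card (ends G a) = 2"
    using assms(1) finite_G loopless_G by (auto simp: finite_multigraph_def loopless_def)
  then obtain x y where "ends G a = {x, y}" "x \<noteq> y" by (auto simp: card_2_iff)
  then show ?thesis using that[of x] that[of y] assms(2) ends_subset[OF assms(1)] by auto
qed

section \<open>Choice functions and the basin of the root\<close>

text \<open>The index set of the expanded product. \<open>PiE\<close> fixes the value
  \<open>undefined\<close> elsewhere, so that each term belongs to exactly one function.\<close>

definition choices :: "('v \<Rightarrow> 'e) set" where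
  "choices = PiE (verts G - {r}) (incident_edges G)"

definition step :: "('v \<Rightarrow> 'e) \<Rightarrow> ('v \<times> 'v) set" where
  "step f = {(u, w). u \<in> verts G - {r} \<and> ends G (f u) = {u, w}}"

definition basin :: "('v \<Rightarrow> 'e) \<Rightarrow> 'v set" where
  "basin f = {u \<in> verts G. (u, r) \<in> (step f)\<^sup>*}"

definition basin_tree :: "('v \<Rightarrow> 'e) \<Rightarrow> ('v, 'e) mgraph" where
  "basin_tree f = \<lparr>verts = basin f, edges = f ` (basin f - {r}), ends = ends G\<rparr>"

lemma basin_tree_simps [simp]:
  "verts (basin_tree f) = basin f" "edges (basin_tree f) = f ` (basin f - {r})"
  "ends (basin_tree f) = ends G"
  by (simp_all add: basin_tree_def)

lemma root_in_basin: "r \<in> basin f"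
  using root by (simp add: basin_def)

lemma basin_subset: "basin f \<subseteq> verts G"
  by (auto simp: basin_def)

lemma choiceD:
  assumes "f \<in> choices" "u \<in> verts G - {r}"
  shows "f u \<in> edges G" "u \<in> ends G (f u)"
proof -
  have "f u \<in> incident_edges G u" using assms unfolding choices_def by (rule PiE_mem)
  then show "f u \<in> edges G" "u \<in> ends G (f u)" by (simp_all add: incident_edges_def)
qed

lemma step_exists:
  assumes "f \<in> choices" "u \<in> verts G - {r}"
  obtains w where "(u, w) \<in> step f" "w \<noteq> u" "w \<in> verts G"
  using other_end[OF choiceD[OF assms]] assms(2) by (auto simp: step_def)

lemma step_unique: "(u, w) \<in> step f \<Longrightarrow> (u, w') \<in> step f \<Longrightarrow> w = w'"
  by (auto simp: step_def doubleton_eq_iff)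

text \<open>Since steps are unique, a walk from \<open>u\<close> to the root must begin with the
  step to \<open>w\<close>. Hence no chosen edge joins the basin to its complement.\<close>

lemma step_basin_iff:
  assumes "f \<in> choices" "(u, w) \<in> step f"
  shows "u \<in> basin f \<longleftrightarrow> w \<in> basin f"
proof -
  have u: "u \<in> verts G - {r}" using assms(2) by (simp add: step_def)
  have w: "w \<in> verts G"
    using step_exists[OF assms(1) u] step_unique[OF assms(2)] by metis
  have "(u, r) \<in> (step f)\<^sup>* \<longleftrightarrow> (w, r) \<in> (step f)\<^sup>*"
  proof
    assume "(u, r) \<in> (step f)\<^sup>*"
    then obtain w' where "(u, w') \<in> step f" "(w', r) \<in> (step f)\<^sup>*"
      using u by (metis Diff_iff converse_rtranclE singletonI)
    then show "(w, r) \<in> (step f)\<^sup>*" using step_unique[OF assms(2)] by metis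
  next
    assume "(w, r) \<in> (step f)\<^sup>*"
    with assms(2) show "(u, r) \<in> (step f)\<^sup>*" by (rule converse_rtrancl_into_rtrancl)
  qed
  then show ?thesis using u w by (simp add: basin_def)
qed

lemma step_steps_to_decrease:
  assumes "(u, w) \<in> step f" "u \<in> basin f"
  shows "steps_to (step f) r w < steps_to (step f) r u"
proof -
  have "(u, r) \<in> (step f)\<^sup>*" "u \<noteq> r" using assms by (auto simp: basin_def step_def)
  then show ?thesis using steps_to_decrease step_unique[OF assms(1)] by metis
qed

text \<open>Two vertices choosing the same edge would be its two ends and step to each other, so
  each would be strictly nearer to the root than the other.\<close>

lemma inj_on_basin:
  assumes "f \<in> choices"
  shows "inj_on f (basin f - {r})"
proof (rule inj_onI, rule ccontr)
  fix u u' assume u: "u \<in> basin f - {r}" "u' \<in> basin f - {r}" "f u = f u'" "u \<noteq> u'"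
  have v: "u \<in> verts G - {r}" "u' \<in> verts G - {r}" using u basin_subset by auto
  have e: "u \<in> ends G (f u)" "u' \<in> ends G (f u)"
    using choiceD(2)[OF assms v(1)] choiceD(2)[OF assms v(2)] u(3) by auto
  obtain w where "ends G (f u) = {u, w}" using other_end[OF choiceD[OF assms v(1)]] by metis
  with e u(4) have "ends G (f u) = {u, u'}" by auto
  then have "(u, u') \<in> step f" "(u', u) \<in> step f"
    using v u(3) by (auto simp: step_def insert_commute)
  then show False using step_steps_to_decrease[of u u' f] step_steps_to_decrease[of u' u f] u by auto
qed

section \<open>The basin with its chosen edges is a tree\<close>

lemma basin_tree_subgraph:
  assumes "f \<in> choices"
  shows "subgraph (basin_tree f) G"
proof -
  have "ends G (f u) \<subseteq> basin f" if "u \<in> basin f - {r}" for u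
  proof -
    have v: "u \<in> verts G - {r}" using that basin_subset by auto
    obtain w where w: "(u, w) \<in> step f" using step_exists[OF assms v] by metis
    then have "w \<in> basin f" using step_basin_iff[OF assms w] that by simp
    then show ?thesis using w that by (auto simp: step_def)
  qed
  moreover have "f ` (basin f - {r}) \<subseteq> edges G" using choiceD[OF assms] basin_subset by blast
  ultimately show ?thesis using basin_subset by (auto simp: subgraph_def)
qed

text \<open>A walk of \<open>step f\<close> to the root stays in the basin and uses chosen edges
  only, so it is also a walk in the tree; adjacency is symmetric.\<close>

lemma basin_tree_connected: "connected_graph (basin_tree f)"
proof -
  let ?A = "adjacency (basin_tree f)"
  have to_root: "(u, r) \<in> ?A\<^sup>*" if "u \<in> basin f" for u
  proof -
    from that have "(u, r) \<in> (step f)\<^sup>*" by (simp add: basin_def)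
    then show ?thesis
    proof (induction rule: converse_rtrancl_induct)
      case (step u w)
      then have "u \<in> basin f - {r}" "ends G (f u) = {u, w}"
        by (auto simp: basin_def step_def intro: converse_rtrancl_into_rtrancl)
      then have "(u, w) \<in> ?A" by (auto simp: adjacency_def)
      then show ?case using step(3) by (rule converse_rtrancl_into_rtrancl)
    qed simp
  qed
  have "sym (?A\<^sup>*)" by (rule sym_rtrancl) (auto simp: sym_def adjacency_def insert_commute)
  then have "(u, w) \<in> ?A\<^sup>*" if "u \<in> basin f" "w \<in> basin f" for u w
    using to_root[OF that(1)] to_root[OF that(2)] by (meson rtrancl_trans symE)
  then show ?thesis using root_in_basin by (auto simp: connected_graph_def)
qed

lemma basin_tree_acyclic:
  assumes f: "f \<in> choices"
  shows "\<not> is_cycle (basin_tree f) us as"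
proof
  assume "is_cycle (basin_tree f) us as"
  then have c: "as \<noteq> []" "length us = length as" "distinct us" "distinct as"
    "set as \<subseteq> f ` (basin f - {r})"
    "\<And>i. i < length as \<Longrightarrow> ends G (as ! i) = {us ! i, us ! (Suc i mod length as)}"
    by (auto simp: is_cycle_def)
  let ?d = "steps_to (step f) r" and ?n = "length as"
  txt \<open>A cycle vertex farthest from the root has chosen both of its cycle edges.\<close>
  have "Max (?d ` set us) \<in> ?d ` set us" using c(1,2) by (intro Max_in) auto
  then obtain x where "x \<in> set us" "?d x = Max (?d ` set us)" by fastforce
  then have x: "x \<in> set us" "\<And>y. y \<in> set us \<Longrightarrow> ?d y \<le> ?d x" by auto
  then obtain i where i: "i < ?n" "us ! i = x" using c(2) by (auto simp: in_set_conv_nth)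
  \<comment> \<open>The edge \<open>b\<close> was chosen by one of its ends. Were this
    \<open>y\<close>, then \<open>y\<close> would step to \<open>x\<close> and be farther from the
    root than \<open>x\<close>.\<close>
  have *: "b = f x" if b: "b \<in> set as" "ends G b = {x, y}" "y \<in> set us" for b y
  proof -
    obtain z where z: "z \<in> basin f - {r}" "b = f z" using b(1) c(5) by auto
    then have v: "z \<in> verts G - {r}" using basin_subset by auto
    have "z = x"
    proof (rule ccontr)
      assume "z \<noteq> x"
      then have "z = y" using choiceD(2)[OF f v] b(2) z(2) by auto
      then have "(y, x) \<in> step f" using b(2) z v by (auto simp: step_def insert_commute)
      then have "?d x < ?d y" using z \<open>z = y\<close> by (auto intro: step_steps_to_decrease)
      then show False using x(2)[OF b(3)] by simp
    qed
    then show ?thesis using z by simp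
  qed
  have n: "0 < ?n" using c(1) by simp
  \<comment> \<open>\<open>j\<close> is the cyclic predecessor of \<open>i\<close>, so
    \<open>as ! j\<close> and \<open>as ! i\<close> are the cycle edges before and after
    \<open>x\<close>.\<close>
  define j where "j = (if i = 0 then ?n - 1 else i - 1)"
  have j: "j < ?n" "Suc j mod ?n = i" using i(1) n by (auto simp: j_def)
  have mem: "us ! k \<in> set us" if "k < ?n" for k using that c(2) by simp
  have "as ! i = f x"
    using *[of "as ! i" "us ! (Suc i mod ?n)"] c(6)[OF i(1)] i mem n by simp
  moreover have "as ! j = f x"
    using *[of "as ! j" "us ! j"] c(6)[OF j(1)] i j mem by (simp add: insert_commute)
  \<comment> \<open>What remains is a cycle of length one, that is, a loop at
    \<open>x\<close>.\<close>
  ultimately have "i = j" using c(4) i(1) j(1) by (metis nth_eq_iff_index_eq)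
  then have e: "ends G (as ! i) = {x}" using c(6)[OF j(1)] i j by simp
  have "as ! i \<in> edges G"
    using basin_tree_subgraph[OF f] c(5) i(1) by (force simp: subgraph_def)
  then show False using other_end[of "as ! i" x] e by (auto simp: doubleton_eq_iff)
qed

lemma basin_tree_is_tree: "f \<in> choices \<Longrightarrow> is_tree (basin_tree f)"
  using basin_tree_connected basin_tree_acyclic by (simp add: is_tree_def)

section \<open>Trees through the root correspond to choices on their vertices\<close>

text \<open>Induction on the distance to the root under \<open>g\<close>. If \<open>f u\<close>
  differs from \<open>g u\<close>, the tree edge \<open>g u\<close> must be chosen under
  \<open>f\<close> by its other end \<open>w\<close>. As \<open>w\<close> is nearer to the root,
  \<open>g w = f w = g u\<close>, against injectivity of \<open>g\<close>.\<close>

lemma basin_tree_determines_choice: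
  assumes f: "f \<in> choices" and g: "g \<in> choices" and eq: "basin_tree f = basin_tree g"
    and "u \<in> basin f - {r}"
  shows "f u = g u"
proof -
  have "basin f = basin g" using arg_cong[OF eq, of verts] by simp
  moreover have "f ` (basin f - {r}) = g ` (basin g - {r})"
    using arg_cong[OF eq, of edges] by simp
  ultimately have b: "basin f = basin g" "f ` (basin f - {r}) = g ` (basin f - {r})"
    by simp_all
  from assms(4) show ?thesis
  proof (induction "steps_to (step g) r u" arbitrary: u rule: less_induct)
    case less
    show ?case
    proof (rule ccontr)
      assume ne: "f u \<noteq> g u"
      have v: "u \<in> verts G - {r}" using less(2) basin_subset by auto
      obtain w where w: "(u, w) \<in> step g" "w \<noteq> u" using step_exists[OF g v] by metis
      have "g u \<in> f ` (basin f - {r})" using b less(2) by blast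
      then obtain x where x: "x \<in> basin f - {r}" "f x = g u" by (metis imageE)
      then have "x \<in> ends G (g u)" using choiceD(2)[OF f, of x] basin_subset by auto
      then have "x = w" using w x ne by (auto simp: step_def)
      moreover have "steps_to (step g) r w < steps_to (step g) r u"
        using step_steps_to_decrease[OF w(1)] less(2) b by auto
      ultimately have "g w = g u" using less(1)[of w] x by simp
      then show False
        using inj_on_basin[OF g] w(2) less(2) x \<open>x = w\<close> b by (auto dest: inj_onD)
    qed
  qed
qed

text \<open>Each vertex of \<open>T\<close> other than \<open>r\<close> chooses an edge towards a
  vertex nearer to \<open>r\<close> in \<open>T\<close>, and \<open>h\<close> supplies the choices
  outside \<open>T\<close>.\<close>

lemma tree_has_choice:
  assumes T: "subgraph T G" "is_tree T" "r \<in> verts T"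
    and h: "h \<in> PiE (verts G - verts T) (incident_edges (delete_verts G (verts T)))"
  obtains f where "f \<in> choices" "basin_tree f = T" "restrict f (verts G - verts T) = h"
proof -
  have sub: "verts T \<subseteq> verts G" "edges T \<subseteq> edges G" "ends T = ends G"
    using T(1) unfolding subgraph_def by blast+
  have "ends T a \<subseteq> verts T" if "a \<in> edges T" for a
    using T(1) that unfolding subgraph_def by blast
  then have inc: "ends G a \<subseteq> verts T" if "a \<in> edges T" for a
    using that by (simp only: sub(3))
  let ?d = "steps_to (adjacency T) r"
  have "\<exists>a w. a \<in> edges T \<and> ends G a = {u, w} \<and> ?d w < ?d u" if u: "u \<in> verts T - {r}" for u
  proof -
    have "(u, r) \<in> (adjacency T)\<^sup>*" using T u by (auto simp: is_tree_def connected_graph_def)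
    then obtain w where "(u, w) \<in> adjacency T" "?d w < ?d u"
      by (rule steps_to_decrease) (use u in auto)
    then show ?thesis by (auto simp: adjacency_def sub)
  qed
  then obtain p q where p: "\<And>u. u \<in> verts T - {r} \<Longrightarrow>
      p u \<in> edges T \<and> ends G (p u) = {u, q u} \<and> ?d (q u) < ?d u"
    by metis
  \<comment> \<open>The value at \<open>r\<close> has to be \<open>undefined\<close> for
    \<open>f\<close> to lie in \<open>choices\<close>; outside \<open>verts G\<close> this value
    comes from \<open>h\<close>.\<close>
  define f where "f u = (if u \<in> verts T then if u = r then undefined else p u else h u)" for u
  have h': "h u \<in> edges G" "u \<in> ends G (h u)" "ends G (h u) \<subseteq> verts G - verts T"
    if "u \<in> verts G - verts T" for u
    using PiE_mem[OF h that] by (auto simp: incident_edges_def delete_verts_def)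
  have f: "f \<in> choices"
    unfolding choices_def
  proof (rule PiE_I)
    fix u assume "u \<in> verts G - {r}"
    then show "f u \<in> incident_edges G u"
      using p[of u] h'(1,2)[of u] sub(2) by (auto simp: f_def incident_edges_def)
  next
    fix u assume "u \<notin> verts G - {r}"
    then show "f u = undefined"
      using sub(1) T(3) PiE_arb[OF h, of u] by (auto simp: f_def)
  qed
  have in_basin: "u \<in> basin f" if "u \<in> verts T" for u
    using that
  proof (induction "?d u" arbitrary: u rule: less_induct)
    case less
    show ?case
    proof (cases "u = r")
      case True then show ?thesis by (simp add: root_in_basin)
    next
      case False
      then have pu: "p u \<in> edges T" "ends G (p u) = {u, q u}" "?d (q u) < ?d u"
        using p[of u] less(2) by auto
      then have "q u \<in> basin f" using less(1)[of "q u"] inc[of "p u"] by auto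
      moreover have "(u, q u) \<in> step f"
        using pu False less(2) sub(1) by (auto simp: step_def f_def)
      ultimately show ?thesis using step_basin_iff[OF f] by blast
    qed
  qed
  \<comment> \<open>Going backwards along a walk from the root never leaves \<open>T\<close>,
    because the edges chosen by \<open>h\<close> avoid \<open>verts T\<close>.\<close>
  have "u \<in> verts T" if "(u, r) \<in> (step f)\<^sup>*" for u
    using that
  proof (induction rule: converse_rtrancl_induct)
    case base show ?case by (rule T(3))
  next
    case (step u w)
    show ?case
    proof (rule ccontr)
      assume "u \<notin> verts T"
      with step(1) have "u \<in> verts G - verts T" "ends G (h u) = {u, w}"
        by (auto simp: step_def f_def)
      then show False using h'(3)[of u] step(3) by auto
    qed
  qed
  with in_basin have basin: "basin f = verts T" by (auto simp: basin_def)
  have im: "f ` (basin f - {r}) \<subseteq> edges T" using p by (auto simp: basin f_def)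
  \<comment> \<open>The chosen edges already connect \<open>verts T\<close>, so a further edge of
    \<open>T\<close> would close a cycle with a path of chosen edges.\<close>
  moreover have "a \<in> f ` (basin f - {r})" if a: "a \<in> edges T" for a
  proof (rule ccontr)
    assume na: "a \<notin> f ` (basin f - {r})"
    have "a \<in> edges G" "ends G a \<noteq> {}"
      using a sub(2) finite_G by (force simp: finite_multigraph_def)+
    then obtain u w where uw: "ends G a = {u, w}" using other_end by (metis ex_in_conv)
    then have v: "u \<in> basin f" "w \<in> basin f" using inc[OF a] basin by auto
    have "(u, w) \<in> (adjacency (basin_tree f))\<^sup>*"
      using basin_tree_connected[of f] v by (auto simp: connected_graph_def)
    then obtain us as where pth: "is_path (basin_tree f) us as" "us ! 0 = u" "us ! length as = w"
      by (rule connected_imp_path)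
        (use v basin_tree_subgraph[OF f] in \<open>auto simp: subgraph_def\<close>)
    have "is_path T us as" using pth(1) im by (auto simp: is_path_def basin sub(3))
    moreover have "a \<notin> set as" using pth(1) na by (auto simp: is_path_def)
    ultimately have "is_cycle T us (as @ [a])"
      using a uw pth(2,3) sub(3) by (intro path_closing_edge_imp_cycle) auto
    then show False using T(2) by (auto simp: is_tree_def)
  qed
  ultimately have "f ` (basin f - {r}) = edges T" by blast
  then have "basin_tree f = T" using basin sub(3) by (simp add: basin_tree_def)
  moreover have "restrict f (verts G - verts T) = h"
  proof
    fix u show "restrict f (verts G - verts T) u = h u"
      using PiE_arb[OF h, of u] by (auto simp: f_def restrict_def)
  qed
  ultimately show ?thesis using that f by blast
qed

section \<open>The expansion of the degree product\<close>

definition root_trees :: "('v, 'e) mgraph set" where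
  "root_trees = {T. subgraph T G \<and> is_tree T \<and> r \<in> verts T}"

text \<open>The tree determines the choices inside the basin, the restriction records those outside.
  An outer vertex steps to an outer vertex, so its edge survives in \<open>delete_verts\<close>.
  Surjectivity is \<open>tree_has_choice\<close>.\<close>

lemma choices_bij_betw:
  "bij_betw (\<lambda>f. (basin_tree f, restrict f (verts G - basin f))) choices
     (SIGMA T:root_trees. PiE (verts G - verts T) (incident_edges (delete_verts G (verts T))))"
    (is "bij_betw ?\<Phi> _ ?S")
proof (rule bij_betwI')
  fix f g assume fg: "f \<in> choices" "g \<in> choices"
  show "?\<Phi> f = ?\<Phi> g \<longleftrightarrow> f = g"
  proof
    assume eq: "?\<Phi> f = ?\<Phi> g"
    then have t: "basin_tree f = basin_tree g" by simp
    then have b: "basin f = basin g" by (metis basin_tree_simps(1))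
    show "f = g"
    proof (rule PiE_ext)
      show "f \<in> PiE (verts G - {r}) (incident_edges G)" "g \<in> PiE (verts G - {r}) (incident_edges G)"
        using fg by (simp_all add: choices_def)
      fix u assume u: "u \<in> verts G - {r}"
      show "f u = g u"
      proof (cases "u \<in> basin f")
        case True
        then show ?thesis using basin_tree_determines_choice[OF fg t] u by auto
      next
        case False
        moreover have "restrict f (verts G - basin f) u = restrict g (verts G - basin f) u"
          using eq b by simp
        ultimately show ?thesis using u by simp
      qed
    qed
  qed simp
next
  fix f assume f: "f \<in> choices"
  have "f u \<in> incident_edges (delete_verts G (basin f)) u" if u: "u \<in> verts G - basin f" for u
  proof -
    have v: "u \<in> verts G - {r}" using u root_in_basin by auto
    obtain w where w: "(u, w) \<in> step f" "w \<in> verts G" using step_exists[OF f v] by metis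
    then have "w \<notin> basin f" using step_basin_iff[OF f] u by blast
    then show ?thesis
      using choiceD[OF f v] w u by (auto simp: incident_edges_def delete_verts_def step_def)
  qed
  then show "?\<Phi> f \<in> ?S"
    using basin_tree_subgraph[OF f] basin_tree_is_tree[OF f] root_in_basin
    by (auto simp: root_trees_def)
next
  fix y assume "y \<in> ?S"
  then obtain T h where y: "y = (T, h)" "T \<in> root_trees"
    "h \<in> PiE (verts G - verts T) (incident_edges (delete_verts G (verts T)))" by auto
  then obtain f where f: "f \<in> choices" "basin_tree f = T" "restrict f (verts G - verts T) = h"
    using tree_has_choice[of T h] by (auto simp: root_trees_def)
  then have "basin f = verts T" by (metis basin_tree_simps(1))
  then show "\<exists>f\<in>choices. y = ?\<Phi> f" using f y by auto
qed

lemma finite_root_trees: "finite root_trees"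
  by (rule finite_subset[OF _ finite_subgraphs[OF finite_G]]) (auto simp: root_trees_def)

text \<open>The product is expanded into a sum over choices and reindexed by pairs of a tree and an
  outer choice. For a fixed tree, the sum over outer choices folds back into a product by the same
  expansion law.\<close>

lemma degree_product_expansion:
  fixes \<omega> :: "'e \<Rightarrow> 'r::comm_semiring_1"
  shows "(\<Prod>u\<in>verts G - {r}. \<Sum>a\<in>incident_edges G u. \<omega> a) =
    (\<Sum>T\<in>root_trees. tree_weight T \<omega> * degree_product (delete_verts G (verts T)) \<omega>)"
proof -
  let ?P = "\<lambda>T. PiE (verts G - verts T) (incident_edges (delete_verts G (verts T)))"
  have fin: "finite (incident_edges G u)" "finite (incident_edges (delete_verts G S) u)" for u S
    using finite_edges by (auto simp: incident_edges_def delete_verts_def)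
  have finP: "finite (?P T)" for T :: "('v, 'e) mgraph"
    using finite_verts fin(2) by (intro finite_PiE) auto
  \<comment> \<open>Injectivity of \<open>f\<close> on the basin makes the product over tree edges a
    product over the vertices choosing them.\<close>
  have weight: "(\<Prod>u\<in>verts G - {r}. \<omega> (f u)) =
      tree_weight (basin_tree f) \<omega> *
        (\<Prod>u\<in>verts G - basin f. \<omega> (restrict f (verts G - basin f) u))"
    if f: "f \<in> choices" for f
  proof -
    have "verts G - {r} = (basin f - {r}) \<union> (verts G - basin f)"
      using basin_subset root_in_basin by auto
    then have "(\<Prod>u\<in>verts G - {r}. \<omega> (f u)) =
        (\<Prod>u\<in>basin f - {r}. \<omega> (f u)) * (\<Prod>u\<in>verts G - basin f. \<omega> (f u))"
      using finite_subset[OF basin_subset finite_verts] finite_verts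
      by (simp only:) (rule prod.union_disjoint, auto)
    then show ?thesis
      by (simp add: tree_weight_def prod.reindex[OF inj_on_basin[OF f]])
  qed
  have "(\<Prod>u\<in>verts G - {r}. \<Sum>a\<in>incident_edges G u. \<omega> a) =
      (\<Sum>f\<in>choices. \<Prod>u\<in>verts G - {r}. \<omega> (f u))"
    unfolding choices_def using finite_verts fin(1) by (intro prod_sum_PiE) auto
  \<comment> \<open>The summand is written as a function of the image pair, the form needed for
    reindexing along the bijection.\<close>
  also have "\<dots> = (\<Sum>f\<in>choices. (\<lambda>(T, h). tree_weight T \<omega> * (\<Prod>u\<in>verts G - verts T. \<omega> (h u)))
      (basin_tree f, restrict f (verts G - basin f)))"
    using weight by (intro sum.cong) auto
  also have "\<dots> = (\<Sum>(T, h)\<in>Sigma root_trees ?P.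
      tree_weight T \<omega> * (\<Prod>u\<in>verts G - verts T. \<omega> (h u)))"
    by (rule sum.reindex_bij_betw[OF choices_bij_betw])
  also have "\<dots> = (\<Sum>T\<in>root_trees. \<Sum>h\<in>?P T. tree_weight T \<omega> * (\<Prod>u\<in>verts G - verts T. \<omega> (h u)))"
    using finP by (intro sum.Sigma[symmetric] finite_root_trees) auto
  also have "\<dots> = (\<Sum>T\<in>root_trees. tree_weight T \<omega> * degree_product (delete_verts G (verts T)) \<omega>)"
  proof (rule sum.cong[OF refl])
    fix T :: "('v, 'e) mgraph"
    have "(\<Sum>h\<in>?P T. \<Prod>u\<in>verts G - verts T. \<omega> (h u)) =
        degree_product (delete_verts G (verts T)) \<omega>"
      unfolding degree_product_def using finite_verts fin(2)
      by (subst prod_sum_PiE) (auto simp: delete_verts_def)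
    then show "(\<Sum>h\<in>?P T. tree_weight T \<omega> * (\<Prod>u\<in>verts G - verts T. \<omega> (h u))) =
        tree_weight T \<omega> * degree_product (delete_verts G (verts T)) \<omega>"
      by (simp add: sum_distrib_left[symmetric])
  qed
  finally show ?thesis .
qed

lemma root_trees_split:
  "root_trees = spanning_trees G \<union> NST r G" "spanning_trees G \<inter> NST r G = {}"
  using root by (auto simp: root_trees_def spanning_trees_def NST_def)

text \<open>A spanning tree leaves no vertices, so its second factor is the empty product 1.\<close>

lemma degree_product_expansion_spanning:
  fixes \<omega> :: "'e \<Rightarrow> 'r::comm_semiring_1"
  shows "(\<Prod>u\<in>verts G - {r}. \<Sum>a\<in>incident_edges G u. \<omega> a) = spanning_tree_sum G \<omega> +
    (\<Sum>T\<in>NST r G. tree_weight T \<omega> * degree_product (delete_verts G (verts T)) \<omega>)"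
proof -
  have "finite (spanning_trees G)" "finite (NST r G)"
    using finite_root_trees by (simp_all add: root_trees_split(1))
  moreover have "(\<Sum>T\<in>spanning_trees G. tree_weight T \<omega> *
      degree_product (delete_verts G (verts T)) \<omega>) = spanning_tree_sum G \<omega>"
    unfolding spanning_tree_sum_def
    by (intro sum.cong) (auto simp: spanning_trees_def degree_product_def delete_verts_def)
  ultimately show ?thesis
    by (simp add: degree_product_expansion root_trees_split sum.union_disjoint)
qed

end

section \<open>Passage to numbered vertices\<close>

theorem theorem3:
  fixes G :: "('v, 'e) mgraph"
    and n m :: nat
    and v :: "nat \<Rightarrow> 'v"
    and e :: "nat \<Rightarrow> 'e"
    and \<omega> :: "'e \<Rightarrow> (nat \<Rightarrow>\<^sub>0 nat) \<Rightarrow>\<^sub>0 'k::comm_ring_1"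
  assumes "finite_multigraph G"
    and "loopless G"
    and "connected_graph G"
    and "bij_betw v {1..n} (verts G)"
    and "bij_betw e {1..m} (edges G)"
    and "\<And>j. j \<in> {1..m} \<Longrightarrow> \<omega> (e j) = indeterminate j"
  shows "(\<Prod>i=1..n-1. \<Sum>a\<in>incident_edges G (v i). \<omega> a) =
    spanning_tree_sum G \<omega> +
    (\<Sum>T\<in>NST (v n) G. tree_weight T \<omega> * degree_product (delete_verts G (verts T)) \<omega>)"

proof -
  \<comment> \<open>For \<open>n = 0\<close> the graph would have no vertices, whereas a connected
    graph has one; so \<open>v n\<close> is a vertex and \<open>n-1\<close> is a true
    predecessor.\<close>
  have n: "n \<ge> 1"
  proof (rule ccontr)
    assume "\<not> n \<ge> 1"
    then show False using assms(3,4) by (simp add: bij_betw_def connected_graph_def)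
  qed
  then have "v n \<in> verts G" using assms(4) by (auto simp: bij_betw_def)
  then interpret rooted_multigraph G "v n"
    using assms(1,2) by unfold_locales
  have "bij_betw v ({1..n} - {n}) (verts G - {v n})"
    using n root by (intro bij_betw_DiffI assms(4)) auto
  moreover have "{1..n} - {n} = {1..n-1}" using n by auto
  ultimately have "bij_betw v {1..n-1} (verts G - {v n})" by (simp only:)
  from prod.reindex_bij_betw[OF this, of "\<lambda>u. \<Sum>a\<in>incident_edges G u. \<omega> a"]
  show ?thesis by (simp only: degree_product_expansion_spanning)
qed

end
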